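(* Let $U\subseteq\mathbb{R}^N$ be an open region, let $V:U\to\mathbb{R}$ be two times differentiable without stationary points in $U$, and let $L$ be the level set wave operator of $V$, $$L=\Delta-G(\mathbf{q})\,\frac{\partial^2}{\partial\nu^2}+\operatorname{Tr}\mathbf{H}(\mathbf{q})\,\frac{\partial}{\partial\nu},$$ acting on functions of $(\mathbf{q},\nu)\in U\times\mathbb{R}$. Let $F:\mathbb{R}\to\mathbb{R}$ be a function of one real variable with continuous first and second derivatives. Then $$\psi(\mathbf{q},\nu):=F\big(V(\mathbf{q})-\nu\big)$$ is a solution of the wave equation $L\psi(\mathbf{q},\nu)=0$ on $U\times\mathbb{R}$.
   Context: Cartesian coordinates $\mathbf{q}=(q^1,\dots,q^N)^T\in\mathbb{R}^N$ are used, together with one additional real coordinate $\nu$ (the level). For the given function $V$: - $G(\mathbf{q}):=\sum_{i=1}^N\left(\frac{\partial V}{\partial q^i}(\mathbf{q})\right)^2$ is the scalar product of the gradient of $V$ with itself. Since $V$ has no stationary points in the region considered, $G(\mathbf{q})>0$ there. - $\mathbf{H}(\mathbf{q}):=\left(\frac{\partial^2V}{\partial q^i\partial q^j}(\mathbf{q})\right)_{i,j=1,\dots,N}$ is the Hessian matrix of $V$, and $\operatorname{Tr}\mathbf{H}(\mathbf{q})$ is the sum of its diagonal entries. - $\Delta=\sum_{i=1}^N\left(\frac{\partial}{\partial q^i}\right)^2$ is the Laplacian in the $\mathbf{q}$ variables only. *)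

theory Defs
  imports "HOL-Analysis.Analysis"
begin

text \<open>Two times (Frechet) differentiable on the open set \<open>S\<close>; functions defined on \<open>S\<close> are
  rendered by total functions of which only the values on \<open>S\<close> matter.\<close>

definition twice_differentiable_on ::
    "'a::real_normed_vector set \<Rightarrow> ('a \<Rightarrow> 'b::real_normed_vector) \<Rightarrow> bool" where
  "twice_differentiable_on S f \<longleftrightarrow>
     (\<exists>f' :: 'a \<Rightarrow> 'a \<Rightarrow>\<^sub>L 'b.
        (\<forall>x\<in>S. (f has_derivative blinfun_apply (f' x)) (at x)) \<and>
        (\<forall>x\<in>S. f' differentiable (at x)))"

definition partial_deriv :: "'n::finite \<Rightarrow> (real ^ 'n \<Rightarrow> real) \<Rightarrow> real ^ 'n \<Rightarrow> real" where
  "partial_deriv i f q = deriv (\<lambda>t. f (q + t *\<^sub>R axis i 1)) 0"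

definition gradient :: "(real ^ 'n::finite \<Rightarrow> real) \<Rightarrow> real ^ 'n \<Rightarrow> real ^ 'n" where
  "gradient f q = (\<chi> i. partial_deriv i f q)"

definition stationary_point :: "(real ^ 'n::finite \<Rightarrow> real) \<Rightarrow> real ^ 'n \<Rightarrow> bool" where
  "stationary_point f q \<longleftrightarrow> gradient f q = 0"

definition grad_square :: "(real ^ 'n::finite \<Rightarrow> real) \<Rightarrow> real ^ 'n \<Rightarrow> real" where
  "grad_square V q = (\<Sum>i\<in>UNIV. (partial_deriv i V q)\<^sup>2)"

definition hessian :: "(real ^ 'n::finite \<Rightarrow> real) \<Rightarrow> real ^ 'n \<Rightarrow> real ^ 'n ^ 'n" where
  "hessian V q = (\<chi> i j. partial_deriv i (partial_deriv j V) q)"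

definition laplacian :: "(real ^ 'n::finite \<Rightarrow> real) \<Rightarrow> real ^ 'n \<Rightarrow> real" where
  "laplacian f q = (\<Sum>i\<in>UNIV. partial_deriv i (partial_deriv i f) q)"

definition level_set_wave_op ::
    "(real ^ 'n::finite \<Rightarrow> real) \<Rightarrow> ((real ^ 'n) \<times> real \<Rightarrow> real) \<Rightarrow> (real ^ 'n) \<times> real \<Rightarrow> real" where
  "level_set_wave_op V \<psi> = (\<lambda>(q, \<nu>).
     laplacian (\<lambda>p. \<psi> (p, \<nu>)) q
     - grad_square V q * deriv (deriv (\<lambda>\<mu>. \<psi> (q, \<mu>))) \<nu>
     + trace (hessian V q) * deriv (\<lambda>\<mu>. \<psi> (q, \<mu>)) \<nu>)"

end

theory Submission imports Defs begin

text \<open>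
  Write \<open>s = V q - \<nu>\<close>.  By the chain rule,
  \<open>\<partial>\<^sub>i \<psi> = F' s * \<partial>\<^sub>i V\<close> and \<open>\<partial>\<^sub>i \<partial>\<^sub>i \<psi> = F'' s * (\<partial>\<^sub>i V)\<^sup>2 + F' s * \<partial>\<^sub>i \<partial>\<^sub>i V\<close>, so that
  \<open>\<Delta> \<psi> = F'' s * G + F' s * Tr H\<close> (lemma \<open>laplacian_compose\<close>), while
  \<open>\<partial>\<psi>/\<partial>\<nu> = - F' s\<close> and \<open>\<partial>\<^sup>2\<psi>/\<partial>\<nu>\<^sup>2 = F'' s\<close>.  The two extra terms of the operator are there
  precisely to cancel the two terms of the Laplacian.

  That \<open>\<psi>\<close> is twice differentiable jointly in \<open>(q, \<nu>)\<close> follows from two closure properties of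
  twice differentiability: \<open>(q, \<nu>) \<mapsto> V q - \<nu>\<close> inherits it from \<open>V\<close>, and it is preserved by
  composition with \<open>F\<close> (lemmas \<open>twice_differentiable_on_diff_snd\<close> and
  \<open>twice_differentiable_on_compose\<close>).
\<close>

lemma twice_differentiable_on_compose:
  fixes g :: "'a::real_normed_vector \<Rightarrow> real" and F :: "real \<Rightarrow> real"
  assumes g: "twice_differentiable_on S g"
    and F: "\<And>s. (F has_real_derivative F' s) (at s)"
    and F': "\<And>s. (F' has_real_derivative F'' s) (at s)"
  shows "twice_differentiable_on S (\<lambda>x. F (g x))"
proof -
  obtain g' :: "'a \<Rightarrow> 'a \<Rightarrow>\<^sub>L real"
    where g': "\<And>x. x \<in> S \<Longrightarrow> (g has_derivative blinfun_apply (g' x)) (at x)"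
      and g'': "\<And>x. x \<in> S \<Longrightarrow> g' differentiable (at x)"
    using g unfolding twice_differentiable_on_def by blast
  have "((\<lambda>x. F (g x)) has_derivative blinfun_apply (F' (g x) *\<^sub>R g' x)) (at x)" if "x \<in> S" for x
    using has_derivative_compose[OF g'[OF that] F[of "g x", unfolded has_field_derivative_def]]
    by (simp add: scaleR_blinfun.rep_eq)
  moreover have "(\<lambda>x. F' (g x) *\<^sub>R g' x) differentiable (at x)" if "x \<in> S" for x
  proof (rule differentiable_scaleR)
    show "(\<lambda>x. F' (g x)) differentiable (at x)"
      using has_derivative_compose[OF g'[OF that] F'[of "g x", unfolded has_field_derivative_def]]
      by (rule differentiableI)
  qed (rule g''[OF that])
  ultimately show ?thesis
    unfolding twice_differentiable_on_def by (intro exI[of _ "\<lambda>x. F' (g x) *\<^sub>R g' x"]) simp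
qed

lemma twice_differentiable_on_diff_snd:
  fixes V :: "'a::real_normed_vector \<Rightarrow> 'b::real_normed_vector"
  assumes "twice_differentiable_on U V"
  shows "twice_differentiable_on (U \<times> UNIV) (\<lambda>x. V (fst x) - snd x)"
proof -
  obtain V' :: "'a \<Rightarrow> 'a \<Rightarrow>\<^sub>L 'b"
    where V': "\<And>q. q \<in> U \<Longrightarrow> (V has_derivative blinfun_apply (V' q)) (at q)"
      and V'': "\<And>q. q \<in> U \<Longrightarrow> V' differentiable (at q)"
    using assms unfolding twice_differentiable_on_def by blast
  define D :: "'a \<times> 'b \<Rightarrow> ('a \<times> 'b) \<Rightarrow>\<^sub>L 'b"
    where "D = (\<lambda>x. (V' (fst x) o\<^sub>L Blinfun fst) - Blinfun snd)"
  have D_apply: "blinfun_apply (D x) = (\<lambda>h. V' (fst x) (fst h) - snd h)" for x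
    by (auto simp: D_def fun_eq_iff minus_blinfun.rep_eq bounded_linear_Blinfun_apply
        bounded_linear_fst bounded_linear_snd)
  have fst_deriv: "(fst has_derivative fst) (at x)" for x :: "'a \<times> 'b"
    by (intro bounded_linear_imp_has_derivative bounded_linear_fst)
  have "((\<lambda>x. V (fst x) - snd x) has_derivative blinfun_apply (D x)) (at x)"
    if "fst x \<in> U" for x
    unfolding D_apply
    by (intro has_derivative_diff has_derivative_compose[OF fst_deriv] V' that
        bounded_linear_imp_has_derivative bounded_linear_snd)
  moreover have "D differentiable (at x)" if x: "fst x \<in> U" for x
  proof -
    have "(\<lambda>x::'a \<times> 'b. V' (fst x)) differentiable (at x)"
      using V''[OF x] has_derivative_compose[OF fst_deriv]
      unfolding differentiable_def by blast
    then obtain W where W: "((\<lambda>x::'a \<times> 'b. V' (fst x)) has_derivative W) (at x)"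
      unfolding differentiable_def by blast
    have "((\<lambda>x::'a \<times> 'b. V' (fst x) o\<^sub>L Blinfun fst) has_derivative (\<lambda>h. W h o\<^sub>L Blinfun fst)) (at x)"
      by (rule bounded_linear.has_derivative[OF
            bounded_bilinear.bounded_linear_left[OF bounded_bilinear_blinfun_compose] W])
    then show ?thesis
      unfolding D_def by (intro differentiable_diff differentiable_const differentiableI)
  qed
  ultimately show ?thesis
    unfolding twice_differentiable_on_def by (intro exI[of _ D]) auto
qed

lemma partial_derivI:
  assumes "((\<lambda>t. f (q + t *\<^sub>R axis i 1)) has_real_derivative d) (at 0)"
  shows "partial_deriv i f q = d"
  using assms unfolding partial_deriv_def by (rule DERIV_imp_deriv)

lemma has_derivative_along_axis:
  fixes f :: "real ^ 'n::finite \<Rightarrow> real"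
  assumes "(f has_derivative f') (at q)"
  shows "((\<lambda>t. f (q + t *\<^sub>R axis i 1)) has_real_derivative f' (axis i 1)) (at 0)"
proof -
  have "((\<lambda>t::real. q + t *\<^sub>R axis i 1) has_derivative (\<lambda>t. t *\<^sub>R axis i 1)) (at 0)"
    by (auto intro!: derivative_eq_intros)
  then have "((\<lambda>t. f (q + t *\<^sub>R axis i 1)) has_derivative (\<lambda>t. f' (t *\<^sub>R axis i 1))) (at 0)"
    using assms by (intro has_derivative_compose[of _ _ 0 UNIV f f']) auto
  moreover have "f' (t *\<^sub>R axis i 1) = f' (axis i 1) * t" for t
    using linear_cmul[OF has_derivative_linear[OF assms]] by simp
  ultimately show ?thesis
    by (simp add: has_field_derivative_def)
qed

text \<open>A line through a point of an open set stays in the set for a short while, so formulas for the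
  first partial derivatives that hold on \<open>U\<close> only may be differentiated once more.\<close>

lemma has_derivative_on_line_cong:
  fixes f g :: "real ^ 'n::finite \<Rightarrow> real"
  assumes "open U" "q \<in> U" "\<And>p. p \<in> U \<Longrightarrow> f p = g p"
    and "((\<lambda>t. g (q + t *\<^sub>R axis i 1)) has_real_derivative d) (at 0)"
  shows "((\<lambda>t. f (q + t *\<^sub>R axis i 1)) has_real_derivative d) (at 0)"
proof -
  have "open ((\<lambda>t::real. q + t *\<^sub>R axis i 1) -` U)"
    by (intro open_vimage assms continuous_intros)
  then show ?thesis
    by (rule has_field_derivative_transform_within_open[OF assms(4)]) (use assms in auto)
qed

lemma twice_differentiable_on_partial_derivs:
  fixes V :: "real ^ 'n::finite \<Rightarrow> real"
  assumes "open U" "twice_differentiable_on U V" "q \<in> U"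
  shows "((\<lambda>t. V (q + t *\<^sub>R axis i 1)) has_real_derivative partial_deriv i V q) (at 0)"
    and "((\<lambda>t. partial_deriv j V (q + t *\<^sub>R axis i 1)) has_real_derivative
           partial_deriv i (partial_deriv j V) q) (at 0)"
proof -
  obtain V' :: "real ^ 'n \<Rightarrow> (real ^ 'n) \<Rightarrow>\<^sub>L real"
    where V': "\<And>p. p \<in> U \<Longrightarrow> (V has_derivative blinfun_apply (V' p)) (at p)"
      and V'': "\<And>p. p \<in> U \<Longrightarrow> V' differentiable (at p)"
    using assms(2) unfolding twice_differentiable_on_def by blast
  have first: "partial_deriv k V p = V' p (axis k 1)" if "p \<in> U" for k p
    by (rule partial_derivI[OF has_derivative_along_axis[OF V'[OF that]]])
  show "((\<lambda>t. V (q + t *\<^sub>R axis i 1)) has_real_derivative partial_deriv i V q) (at 0)"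
    unfolding first[OF \<open>q \<in> U\<close>] by (rule has_derivative_along_axis[OF V'[OF \<open>q \<in> U\<close>]])
  obtain W where W: "(V' has_derivative W) (at q)"
    using V''[OF \<open>q \<in> U\<close>] unfolding differentiable_def by blast
  have "((\<lambda>p. V' p (axis j 1)) has_derivative (\<lambda>h. W h (axis j 1))) (at q)"
    by (rule bounded_linear.has_derivative[OF
          bounded_bilinear.bounded_linear_left[OF bounded_bilinear_blinfun_apply] W])
  note second = has_derivative_along_axis[OF this]
  have "((\<lambda>t. partial_deriv j V (q + t *\<^sub>R axis i 1)) has_real_derivative
           W (axis i 1) (axis j 1)) (at 0)"
    by (rule has_derivative_on_line_cong[OF assms(1,3) first second])
  with partial_derivI[OF this]
  show "((\<lambda>t. partial_deriv j V (q + t *\<^sub>R axis i 1)) has_real_derivative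
           partial_deriv i (partial_deriv j V) q) (at 0)"
    by simp
qed

lemma laplacian_compose:
  fixes V :: "real ^ 'n::finite \<Rightarrow> real" and F :: "real \<Rightarrow> real"
  assumes U: "open U" and V: "twice_differentiable_on U V" and q: "q \<in> U"
    and F: "\<And>s. (F has_real_derivative F' s) (at s)"
    and F': "\<And>s. (F' has_real_derivative F'' s) (at s)"
  shows "laplacian (\<lambda>p. F (V p - c)) q =
    F'' (V q - c) * grad_square V q + F' (V q - c) * laplacian V q"
proof -
  have shift: "((\<lambda>t. V (p + t *\<^sub>R axis i 1) - c) has_real_derivative partial_deriv i V p) (at 0)"
    if "p \<in> U" for p i
    using DERIV_diff[OF twice_differentiable_on_partial_derivs(1)[OF U V that] DERIV_const] by simp
  have first: "partial_deriv i (\<lambda>p. F (V p - c)) p = F' (V p - c) * partial_deriv i V p"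
    if "p \<in> U" for i p
    by (rule partial_derivI, rule DERIV_chain2[OF _ shift[OF that]]) (simp add: F)
  have "partial_deriv i (partial_deriv i (\<lambda>p. F (V p - c))) q =
      F'' (V q - c) * (partial_deriv i V q)\<^sup>2 + F' (V q - c) * partial_deriv i (partial_deriv i V) q"
    for i
  proof (rule partial_derivI, rule has_derivative_on_line_cong[OF U q first])
    have "((\<lambda>t. F' (V (q + t *\<^sub>R axis i 1) - c)) has_real_derivative
        F'' (V q - c) * partial_deriv i V q) (at 0)"
      by (rule DERIV_chain2[OF _ shift[OF q]]) (simp add: F')
    from DERIV_mult[OF this twice_differentiable_on_partial_derivs(2)[OF U V q, of i i]]
    show "((\<lambda>t. F' (V (q + t *\<^sub>R axis i 1) - c) * partial_deriv i V (q + t *\<^sub>R axis i 1))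
        has_real_derivative F'' (V q - c) * (partial_deriv i V q)\<^sup>2 +
          F' (V q - c) * partial_deriv i (partial_deriv i V) q) (at 0)"
      by (simp add: algebra_simps power2_eq_square)
  qed
  then show ?thesis
    by (simp add: laplacian_def grad_square_def sum.distrib sum_distrib_left)
qed

lemma trace_hessian: "trace (hessian V q) = laplacian V q"
  by (simp add: trace_def hessian_def laplacian_def)

theorem mainTheorem1:
  fixes U :: "(real ^ 'n) set"
    and V :: "real ^ 'n \<Rightarrow> real"
    and F :: "real \<Rightarrow> real"
    and \<psi> :: "(real ^ 'n) \<times> real \<Rightarrow> real"
  assumes "open U"
    and "twice_differentiable_on U V"
    and "\<forall>q\<in>U. \<not> stationary_point V q"
    and "F differentiable_on UNIV" and "continuous_on UNIV (deriv F)"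
    and "deriv F differentiable_on UNIV" and "continuous_on UNIV (deriv (deriv F))"
    and "\<psi> = (\<lambda>(q, \<nu>). F (V q - \<nu>))"
  shows "twice_differentiable_on (U \<times> UNIV) \<psi>
    \<and> (\<forall>(q, \<nu>) \<in> U \<times> UNIV. level_set_wave_op V \<psi> (q, \<nu>) = 0)"
proof
  have F: "(F has_real_derivative deriv F s) (at s)" for s
    using assms(4) unfolding differentiable_on_def
    by (metis DERIV_imp_deriv UNIV_I real_differentiable_def)
  have F': "(deriv F has_real_derivative deriv (deriv F) s) (at s)" for s
    using assms(6) unfolding differentiable_on_def
    by (metis DERIV_imp_deriv UNIV_I real_differentiable_def)
  have psi: "\<psi> = (\<lambda>x. F (V (fst x) - snd x))"
    unfolding assms(8) by (simp add: case_prod_beta')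
  show "twice_differentiable_on (U \<times> UNIV) \<psi>"
    unfolding psi
    by (rule twice_differentiable_on_compose[OF twice_differentiable_on_diff_snd[OF assms(2)] F F'])
  have "level_set_wave_op V \<psi> (q, \<nu>) = 0" if "q \<in> U" for q \<nu>
  proof -
    have level: "((\<lambda>\<mu>. V q - \<mu>) has_real_derivative - 1) (at \<mu>)" for \<mu>
      by (auto intro!: derivative_eq_intros)
    have d1: "deriv (\<lambda>\<mu>. F (V q - \<mu>)) = (\<lambda>\<mu>. - deriv F (V q - \<mu>))"
      using DERIV_imp_deriv[OF DERIV_chain2[OF F level]] by (simp add: fun_eq_iff)
    have d2: "deriv (\<lambda>\<mu>. - deriv F (V q - \<mu>)) \<nu> = deriv (deriv F) (V q - \<nu>)"
      using DERIV_imp_deriv[OF DERIV_minus[OF DERIV_chain2[OF F' level]]] by simp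
    show ?thesis
      by (simp add: level_set_wave_op_def psi d1 d2 trace_hessian
          laplacian_compose[OF assms(1,2) that F F'])
  qed
  then show "\<forall>(q, \<nu>) \<in> U \<times> UNIV. level_set_wave_op V \<psi> (q, \<nu>) = 0"
    by auto
qed

end
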